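(* Let $n\ge 3$ and let $W=S_n$ be the symmetric group, viewed as the Coxeter group of type $A_{n-1}$ with simple reflections $S=\{s_1,\dots,s_{n-1}\}$, $s_i=(i,\,i+1)$. Let $J=S\setminus\{s_{n-1},s_{n-2}\}$ and let $W_J$ be the parabolic subgroup generated by $J$. For distinct $i,j\in\{1,\dots,n\}$ let $\alpha_{ij}=\varepsilon_i-\varepsilon_j$ be the corresponding root of type $A_{n-1}$, with height $\mathrm{ht}(\alpha_{ij})=j-i$, and let $w_{\alpha_{ij}}\in S_n$ be the permutation whose one-line notation is $w=n\,(n-1)\cdots\hat{j}\cdots\hat{i}\cdots 1\; i\; j$, i.e. the $n-2$ values of $\{1,\dots,n\}\setminus\{i,j\}$ listed in decreasing order, followed by $i$ and then $j$. If $\alpha,\beta$ are roots with $\mathrm{ht}(\alpha)=\mathrm{ht}(\beta)$, then the cosets $w_\alpha W_J$ and $w_\beta W_J$ are comparable in the Bruhat order on the left cosets $W/W_J$, i.e. $w_\alpha\le w_\beta$ or $w_\beta\le w_\alpha$ in the Bruhat order of $S_n$.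
   Context: Permutations are written in one-line notation $w=w(1)w(2)\cdots w(n)$, and composition is right to left, $(uv)(k)=u(v(k))$, so right multiplication by $s_i$ swaps the entries in positions $i$ and $i+1$; hence a left coset $wW_J$ is determined by the last two entries $w(n-1),w(n)$. The roots are $\Phi=\{\varepsilon_i-\varepsilon_j: i\ne j\}$ in $\mathbb{R}^n$ with simple roots $\alpha_i=\varepsilon_i-\varepsilon_{i+1}$; the height of a root $\sum_k c_k\alpha_k$ is $\sum_k c_k$, which for $\varepsilon_i-\varepsilon_j$ equals $j-i$. The element $w_{\alpha}$ is the unique Bruhat-maximal element of its coset $w_\alpha W_J$, and the Bruhat order on $W/W_J$ is the order induced by comparing such maximal coset representatives (equivalently, minimal coset representatives) in the Bruhat order of $S_n$. *)

theory Defs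
  imports Complex_Main "HOL-Algebra.Sym_Groups"
begin

section \<open>Bruhat order of a group with a set of simple reflections\<close>

definition word_prod :: "('a, 'b) monoid_scheme \<Rightarrow> 'a list \<Rightarrow> 'a" where
  "word_prod G xs = foldr (\<lambda>x y. x \<otimes>\<^bsub>G\<^esub> y) xs \<one>\<^bsub>G\<^esub>"

definition cox_length :: "('a, 'b) monoid_scheme \<Rightarrow> 'a set \<Rightarrow> 'a \<Rightarrow> nat" where
  "cox_length G S w = (LEAST k. \<exists>xs. set xs \<subseteq> S \<and> length xs = k \<and> word_prod G xs = w)"

definition reflections :: "('a, 'b) monoid_scheme \<Rightarrow> 'a set \<Rightarrow> 'a set" where
  "reflections G S = {x \<otimes>\<^bsub>G\<^esub> s \<otimes>\<^bsub>G\<^esub> inv\<^bsub>G\<^esub> x | x s. x \<in> carrier G \<and> s \<in> S}"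

definition bruhat_step :: "('a, 'b) monoid_scheme \<Rightarrow> 'a set \<Rightarrow> 'a \<Rightarrow> 'a \<Rightarrow> bool" where
  "bruhat_step G S u v \<longleftrightarrow> u \<in> carrier G \<and>
     (\<exists>t \<in> reflections G S. v = u \<otimes>\<^bsub>G\<^esub> t) \<and> cox_length G S u < cox_length G S v"

definition bruhat_le :: "('a, 'b) monoid_scheme \<Rightarrow> 'a set \<Rightarrow> 'a \<Rightarrow> 'a \<Rightarrow> bool" where
  "bruhat_le G S = (bruhat_step G S)\<^sup>*\<^sup>*"

definition bruhat_max_rep :: "('a, 'b) monoid_scheme \<Rightarrow> 'a set \<Rightarrow> 'a set \<Rightarrow> 'a" where
  "bruhat_max_rep G S C = (THE x. x \<in> C \<and> (\<forall>y\<in>C. bruhat_le G S x y \<longrightarrow> y = x))"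

text \<open>The order on left cosets of a parabolic subgroup, compared through their maximal
  representatives.\<close>

definition coset_bruhat_le :: "('a, 'b) monoid_scheme \<Rightarrow> 'a set \<Rightarrow> 'a set \<Rightarrow> 'a set \<Rightarrow> bool" where
  "coset_bruhat_le G S C D \<longleftrightarrow>
     bruhat_le G S (bruhat_max_rep G S C) (bruhat_max_rep G S D)"


section \<open>The symmetric group in type A\<close>

text \<open>The group \<^term>\<open>sym_group n\<close> consists of the permutations of \<open>{1..n}\<close>, extended by the
  identity to all natural numbers, with multiplication \<open>u \<circ> v\<close>.\<close>

definition simple_refl :: "nat \<Rightarrow> nat \<Rightarrow> nat" where
  "simple_refl i = transpose i (i + 1)"

definition simple_refls :: "nat \<Rightarrow> (nat \<Rightarrow> nat) set" where
  "simple_refls n = simple_refl ` {1..n - 1}"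

definition J_set :: "nat \<Rightarrow> (nat \<Rightarrow> nat) set" where
  "J_set n = simple_refls n - {simple_refl (n - 1), simple_refl (n - 2)}"

definition W_J :: "nat \<Rightarrow> (nat \<Rightarrow> nat) set" where
  "W_J n = generate (sym_group n) (J_set n)"

definition one_line :: "nat list \<Rightarrow> nat \<Rightarrow> nat" where
  "one_line xs k = (if k \<in> {1..length xs} then xs ! (k - 1) else k)"

definition w_alpha :: "nat \<Rightarrow> nat \<Rightarrow> nat \<Rightarrow> nat \<Rightarrow> nat" where
  "w_alpha n i j = one_line (filter (\<lambda>v. v \<noteq> i \<and> v \<noteq> j) (rev [1..<n + 1]) @ [i, j])"


section \<open>Roots and heights\<close>

text \<open>Vectors of \<open>\<real>\<^sup>n\<close> are functions \<open>nat \<Rightarrow> real\<close> vanishing outside \<open>{1..n}\<close>.\<close>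

definition eps :: "nat \<Rightarrow> nat \<Rightarrow> real" where
  "eps i = (\<lambda>m. if m = i then 1 else 0)"

definition root_vec :: "nat \<Rightarrow> nat \<Rightarrow> nat \<Rightarrow> real" where
  "root_vec i j = (\<lambda>m. eps i m - eps j m)"

definition simple_root :: "nat \<Rightarrow> nat \<Rightarrow> real" where
  "simple_root k = root_vec k (k + 1)"

definition height :: "nat \<Rightarrow> (nat \<Rightarrow> real) \<Rightarrow> real" where
  "height n v = (THE h. \<exists>c :: nat \<Rightarrow> real.
     v = (\<lambda>m. \<Sum>k = 1..n - 1. c k * simple_root k m) \<and> h = (\<Sum>k = 1..n - 1. c k))"

end

theory Submission
  imports Defs
begin

text \<open>Two roots of equal height differ by a shift \<open>(i, j) \<mapsto> (i + d, j + d)\<close>, and the shift by one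
  is a product of two left multiplications by simple reflections: raising one of the last two
  entries from \<open>m\<close> to \<open>m + 1\<close> swaps the values \<open>m\<close> and \<open>m + 1\<close>, of which \<open>m + 1\<close> stood to the
  left, so it goes down in Bruhat order. If \<open>j = i + 1\<close> then \<open>j\<close>
  has to be raised first, and if \<open>i = j + 1\<close> then \<open>i\<close>. Any element of \<open>w\<^sub>\<alpha> W\<^sub>J\<close> other than \<open>w\<^sub>\<alpha>\<close> has an ascent among its first \<open>n - 2\<close>
  entries and is therefore not maximal in its coset, so \<open>w\<^sub>\<alpha>\<close> is the maximal representative.\<close>

subsection \<open>Length and inversions\<close>

text \<open>Pairs of positions rather than of values: right multiplication by a simple reflection
  relabels such pairs, left multiplication leaves them where they are.\<close>

definition inversions :: "nat \<Rightarrow> (nat \<Rightarrow> nat) \<Rightarrow> (nat \<times> nat) set" where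
  "inversions n w = {(a, b). 1 \<le> a \<and> a < b \<and> b \<le> n \<and> w b < w a}"

lemma finite_inversions: "finite (inversions n w)"
  by (rule finite_subset[of _ "{1..n} \<times> {1..n}"]) (auto simp: inversions_def)

lemma inversions_id [simp]: "inversions n id = {}"
  by (auto simp: inversions_def)

lemma simple_refl_permutes: "1 \<le> p \<Longrightarrow> p < n \<Longrightarrow> simple_refl p permutes {1..n}"
  unfolding simple_refl_def by (rule permutes_swap_id) auto

lemma simple_refl_simple_refl [simp]: "simple_refl p (simple_refl p k) = k"
  by (simp add: simple_refl_def)

lemma simple_refl_comp_simple_refl [simp]: "simple_refl p \<circ> simple_refl p = id"
  by (auto simp: fun_eq_iff)

text \<open>No natural number lies between \<open>p\<close> and \<open>p + 1\<close>, so exchanging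
  these two can only affect their own comparison.\<close>

lemma simple_refl_less_iff:
  "simple_refl p a < simple_refl p b \<longleftrightarrow>
     (if a = p \<and> b = p + 1 then False else if a = p + 1 \<and> b = p then True else a < b)"
  by (auto simp: simple_refl_def transpose_def)

lemma simple_refl_in_range_iff:
  assumes "1 \<le> p" "p < n"
  shows "1 \<le> simple_refl p a \<longleftrightarrow> 1 \<le> a" "simple_refl p a \<le> n \<longleftrightarrow> a \<le> n"
  using assms by (auto simp: simple_refl_def transpose_def)

text \<open>Relabelling positions by \<open>simple_refl p\<close> keeps every pair in order except
  \<open>(p, p + 1)\<close>, which is no inversion of \<open>u\<close> because of the ascent and
  becomes one.\<close>

lemma inversions_comp_simple_refl:
  assumes p: "1 \<le> p" "p < n" and lt: "u p < u (p + 1)"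
  shows "inversions n (u \<circ> simple_refl p) =
    insert (p, p + 1) (map_prod (simple_refl p) (simple_refl p) ` inversions n u)"
proof -
  let ?s = "simple_refl p"
  have s: "?s p = p + 1" "?s (p + 1) = p" by (auto simp: simple_refl_def)
  have "(a, b) \<in> inversions n (u \<circ> ?s) \<longleftrightarrow> (a, b) = (p, p + 1) \<or> (?s a, ?s b) \<in> inversions n u" for a b
    using lt p simple_refl_less_iff[of p a b] simple_refl_in_range_iff[OF p] s
    by (auto simp: inversions_def split: if_splits)
  moreover have "(a, b) \<in> map_prod ?s ?s ` inversions n u \<longleftrightarrow> (?s a, ?s b) \<in> inversions n u" for a b
    by (force simp: image_iff map_prod_def)
  ultimately show ?thesis by auto
qed

lemma card_inversions_comp_simple_refl:
  assumes "1 \<le> p" "p < n" "u p < u (p + 1)"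
  shows "card (inversions n (u \<circ> simple_refl p)) = Suc (card (inversions n u))"
proof -
  let ?f = "map_prod (simple_refl p) (simple_refl p)"
  have "inj ?f" by (metis simple_refl_simple_refl injI prod.inj_map)
  \<comment> \<open>Its only preimage is \<open>(p + 1, p)\<close>, whose positions are in the wrong
    order.\<close>
  moreover have "(p, p + 1) \<notin> ?f ` inversions n u"
    by (auto simp: inversions_def simple_refl_def transpose_def split: if_splits)
  ultimately show ?thesis
    unfolding inversions_comp_simple_refl[OF assms]
    by (simp add: finite_inversions card_image[OF inj_on_subset])
qed

text \<open>At a descent of \<open>u\<close> the product has an ascent, so the exact count applied
  to the product shows that the number drops by one.\<close>

lemma card_inversions_comp_simple_refl_le:
  assumes "1 \<le> p" "p < n" "u permutes {1..n}"
  shows "card (inversions n (u \<circ> simple_refl p)) \<le> Suc (card (inversions n u))"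
proof (cases "u p < u (p + 1)")
  case True
  then show ?thesis using card_inversions_comp_simple_refl assms by simp
next
  case False
  let ?v = "u \<circ> simple_refl p"
  have "u p \<noteq> u (p + 1)"
    using inj_eq[OF permutes_inj[OF assms(3)]] by (metis Suc_eq_plus1 n_not_Suc_n)
  with False have lt: "?v p < ?v (p + 1)" by (auto simp: simple_refl_def)
  have eq: "?v \<circ> simple_refl p = u" by (simp add: fun_eq_iff)
  have "card (inversions n u) = Suc (card (inversions n ?v))"
    using card_inversions_comp_simple_refl[OF assms(1,2) lt] unfolding eq .
  then show ?thesis by linarith
qed

text \<open>Left multiplication by \<open>s\<^sub>i\<close> only exchanges the adjacent values \<open>i\<close> and \<open>i + 1\<close>, so it
  preserves the relative order of all other pairs of entries.\<close>

lemma inversions_simple_refl_comp: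
  assumes "inj u" "1 \<le> a" "a < b" "b \<le> n" "u a = i" "u b = i + 1"
  shows "inversions n (simple_refl i \<circ> u) = insert (a, b) (inversions n u)"
proof -
  have "u c = i \<longleftrightarrow> c = a" "u c = i + 1 \<longleftrightarrow> c = b" for c
    using inj_eq[OF assms(1)] assms by metis+
  then show ?thesis
    using assms by (auto simp: inversions_def simple_refl_less_iff split: if_splits)
qed

lemma card_inversions_simple_refl_comp:
  assumes "inj u" "1 \<le> a" "a < b" "b \<le> n" "u a = i" "u b = i + 1"
  shows "card (inversions n (simple_refl i \<circ> u)) = Suc (card (inversions n u))"
  using assms finite_inversions by (auto simp: inversions_simple_refl_comp) (auto simp: inversions_def)

text \<open>Both sequences are the increasing enumeration of the same set. The general order type
  lets negated integers handle descending sequences.\<close>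

lemma ascending_eqI:
  fixes f g :: "nat \<Rightarrow> 'a::linorder"
  assumes "f ` {1..m} = g ` {1..m}"
    and "\<And>p. 1 \<le> p \<Longrightarrow> p < m \<Longrightarrow> f p < f (p + 1)"
    and "\<And>p. 1 \<le> p \<Longrightarrow> p < m \<Longrightarrow> g p < g (p + 1)"
    and "q \<in> {1..m}"
  shows "f q = g q"
proof -
  have sorted: "sorted_wrt (<) (map h [1..<m + 1])"
    if "\<And>p. 1 \<le> p \<Longrightarrow> p < m \<Longrightarrow> h p < h (p + 1)" for h :: "nat \<Rightarrow> 'a"
    using that by (auto simp: sorted_wrt_iff_nth_Suc_transp nth_append simp del: upt_Suc)
  have set: "set (map h [1..<m + 1]) = h ` {1..m}" for h :: "nat \<Rightarrow> 'a"
    by (auto simp: image_iff simp del: upt_Suc)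
  have "map f [1..<m + 1] = map g [1..<m + 1]"
    using assms set by (intro strict_sorted_equal sorted) auto
  then show ?thesis using assms(4) by (auto simp del: upt_Suc)
qed

text \<open>Without descents, \<open>w\<close> and \<open>id\<close> would both enumerate
  \<open>{1..n}\<close> increasingly.\<close>

lemma permutes_ex_descent:
  fixes w :: "nat \<Rightarrow> nat"
  assumes "w permutes {1..n}" "w \<noteq> id"
  obtains p where "1 \<le> p" "p < n" "w (p + 1) < w p"
proof (rule ccontr)
  note witness = that
  assume no_descent: "\<not> thesis"
  have ascent: "w p < w (p + 1)" if p: "1 \<le> p" "p < n" for p
  proof -
    have "\<not> w (p + 1) < w p" using no_descent witness p by blast
    moreover have "w p \<noteq> w (p + 1)"
      using inj_eq[OF permutes_inj[OF assms(1)]] by (metis Suc_eq_plus1 n_not_Suc_n)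
    ultimately show ?thesis by linarith
  qed
  have "w q = id q" if "q \<in> {1..n}" for q
    using that permutes_image[OF assms(1)] ascent by (intro ascending_eqI[of w n id]) auto
  then have "w = id" using permutes_not_in[OF assms(1)] by (metis eq_id_iff)
  with assms show False by simp
qed

section \<open>Reduced words: the Coxeter length is the number of inversions\<close>

lemma word_prod_sym_group_append:
  "word_prod (sym_group n) (xs @ [s]) = word_prod (sym_group n) xs \<circ> s"
proof -
  have "foldr (\<circ>) xs s = foldr (\<circ>) xs id \<circ> s" for xs :: "(nat \<Rightarrow> nat) list"
    by (induction xs) (auto simp: fun_eq_iff)
  then show ?thesis by (simp add: word_prod_def sym_group_def)
qed

text \<open>Each further letter on the right creates at most one inversion, which bounds word
  lengths from below.\<close>

lemma card_inversions_word_prod_le: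
  assumes "set xs \<subseteq> simple_refls n"
  shows "word_prod (sym_group n) xs permutes {1..n} \<and>
    card (inversions n (word_prod (sym_group n) xs)) \<le> length xs"
  using assms
proof (induction xs rule: rev_induct)
  case Nil
  have "word_prod (sym_group n) [] = id" by (simp add: word_prod_def sym_group_def)
  then show ?case using permutes_id[of "{1..n}"] by (metis card.empty inversions_id le0)
next
  case (snoc s xs)
  then obtain p where p: "s = simple_refl p" "1 \<le> p" "p < n" by (auto simp: simple_refls_def)
  define u where "u = word_prod (sym_group n) xs"
  have u: "u permutes {1..n}" "card (inversions n u) \<le> length xs" using snoc unfolding u_def by auto
  have "u \<circ> s permutes {1..n}"
    unfolding p(1) by (rule permutes_compose[OF simple_refl_permutes[OF p(2,3)] u(1)])
  moreover have "card (inversions n (u \<circ> s)) \<le> Suc (length xs)"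
    using card_inversions_comp_simple_refl_le[OF p(2,3) u(1)] u(2) unfolding p(1) by linarith
  ultimately show ?case by (simp add: word_prod_sym_group_append u_def o_def)
qed

text \<open>Bubble sort: undoing a descent removes exactly one inversion, and the recursion ends at
  the identity.\<close>

lemma ex_reduced_word:
  assumes "w permutes {1..n}"
  shows "\<exists>xs. set xs \<subseteq> simple_refls n \<and> length xs = card (inversions n w) \<and>
    word_prod (sym_group n) xs = w"
  using assms
proof (induction "card (inversions n w)" arbitrary: w rule: less_induct)
  case less
  show ?case
  proof (cases "w = id")
    case True
    then show ?thesis by (intro exI[of _ "[]"]) (simp add: word_prod_def sym_group_def)
  next
    case False
    then obtain p where p: "1 \<le> p" "p < n" "w (p + 1) < w p"
      using permutes_ex_descent less.prems by blast
    define v where "v = w \<circ> simple_refl p"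
    have w: "w = v \<circ> simple_refl p" by (simp add: v_def comp_assoc)
    have "v permutes {1..n}"
      unfolding v_def using less.prems p by (intro permutes_compose simple_refl_permutes)
    moreover have card: "card (inversions n w) = Suc (card (inversions n v))"
      using p unfolding w by (intro card_inversions_comp_simple_refl) (auto simp: v_def simple_refl_def)
    ultimately obtain xs where xs: "set xs \<subseteq> simple_refls n" "length xs = card (inversions n v)"
      "word_prod (sym_group n) xs = v" using less.hyps[of v] by (metis lessI)
    show ?thesis
    proof (intro exI conjI)
      show "set (xs @ [simple_refl p]) \<subseteq> simple_refls n" using xs(1) p by (auto simp: simple_refls_def)
      show "length (xs @ [simple_refl p]) = card (inversions n w)" using xs(2) card by simp
      show "word_prod (sym_group n) (xs @ [simple_refl p]) = w"
        unfolding word_prod_sym_group_append xs(3) by (rule w[symmetric])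
    qed
  qed
qed

lemma cox_length_eq_card_inversions:
  assumes "w permutes {1..n}"
  shows "cox_length (sym_group n) (simple_refls n) w = card (inversions n w)"
  unfolding cox_length_def
proof (rule Least_equality)
  show "\<exists>xs. set xs \<subseteq> simple_refls n \<and> length xs = card (inversions n w) \<and>
      word_prod (sym_group n) xs = w"
    using assms by (rule ex_reduced_word)
  fix k assume "\<exists>xs. set xs \<subseteq> simple_refls n \<and> length xs = k \<and> word_prod (sym_group n) xs = w"
  then show "card (inversions n w) \<le> k" using card_inversions_word_prod_le by metis
qed


subsection \<open>Bruhat steps\<close>

lemma inv_sym_group: "w permutes {1..n} \<Longrightarrow> inv\<^bsub>sym_group n\<^esub> w = inv_into UNIV w"
  by (simp add: sym_group_carrier)

lemma simple_refl_in_simple_refls: "1 \<le> p \<Longrightarrow> p < n \<Longrightarrow> simple_refl p \<in> simple_refls n"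
  by (auto simp: simple_refls_def)

lemma conjugate_in_reflections:
  assumes "x permutes {1..n}" "s \<in> simple_refls n"
  shows "x \<circ> s \<circ> inv_into UNIV x \<in> reflections (sym_group n) (simple_refls n)"
proof -
  have "x \<circ> s \<circ> inv_into UNIV x = x \<otimes>\<^bsub>sym_group n\<^esub> s \<otimes>\<^bsub>sym_group n\<^esub> inv\<^bsub>sym_group n\<^esub> x"
    using assms(1) by (simp add: inv_sym_group sym_group_mult)
  then show ?thesis
    using assms unfolding reflections_def sym_group_carrier by blast
qed

lemma bruhat_step_comp_simple_refl:
  assumes u: "u permutes {1..n}" and p: "1 \<le> p" "p < n" "u p < u (p + 1)"
  shows "bruhat_step (sym_group n) (simple_refls n) u (u \<circ> simple_refl p)"
proof -
  \<comment> \<open>A simple reflection is its own conjugate by the identity.\<close>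
  have "simple_refl p \<in> reflections (sym_group n) (simple_refls n)"
    using conjugate_in_reflections[OF permutes_id simple_refl_in_simple_refls[OF p(1,2)]] by simp
  then show ?thesis
    using u card_inversions_comp_simple_refl[OF p] permutes_compose[OF simple_refl_permutes[OF p(1,2)] u]
    by (auto simp: bruhat_step_def cox_length_eq_card_inversions sym_group_mult sym_group_carrier)
qed

text \<open>\<open>bruhat_step\<close> multiplies on the right; left multiplication by
  \<open>simple_refl i\<close> is right multiplication by its conjugate under the inverse of
  \<open>u\<close>, again a reflection.\<close>

lemma bruhat_step_simple_refl_comp:
  assumes u: "u permutes {1..n}" and ab: "1 \<le> a" "a < b" "b \<le> n" "u a = i" "u b = i + 1"
  shows "bruhat_step (sym_group n) (simple_refls n) u (simple_refl i \<circ> u)"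
proof -
  let ?v = "inv_into UNIV u"
  have "a \<in> {1..n}" "b \<in> {1..n}" using ab by auto
  then have "u a \<in> {1..n}" "u b \<in> {1..n}" by (simp_all only: permutes_in_image[OF u])
  then have i: "1 \<le> i" "i < n" unfolding ab(4,5) by auto
  have v: "?v permutes {1..n}" using u by (rule permutes_inv)
  have "?v \<circ> simple_refl i \<circ> u \<in> reflections (sym_group n) (simple_refls n)"
    using conjugate_in_reflections[OF v simple_refl_in_simple_refls[OF i]]
    by (simp add: permutes_inv_inv[OF u])
  moreover have "simple_refl i \<circ> u = u \<circ> (?v \<circ> simple_refl i \<circ> u)"
    using permutes_inv_o(1)[OF u] by (simp flip: comp_assoc)
  ultimately show ?thesis
    using u card_inversions_simple_refl_comp[OF permutes_inj[OF u] ab]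
      permutes_compose[OF u simple_refl_permutes[OF i]]
    by (auto simp: bruhat_step_def cox_length_eq_card_inversions sym_group_mult sym_group_carrier)
qed

text \<open>Every step raises the length; hence an element of greatest length in a coset is
  Bruhat-maximal there.\<close>

lemma bruhat_le_imp_eq_or_length_less:
  "bruhat_le G S u v \<Longrightarrow> u = v \<or> cox_length G S u < cox_length G S v"
  unfolding bruhat_le_def
  by (induction rule: rtranclp_induct) (auto simp: bruhat_step_def)


subsection \<open>The permutations \<open>w\<^sub>\<alpha>\<close>\<close>

lemma w_alpha_props:
  assumes "i \<in> {1..n}" "j \<in> {1..n}" "i \<noteq> j"
  shows w_alpha_permutes: "w_alpha n i j permutes {1..n}"
    and w_alpha_penultimate: "w_alpha n i j (n - 1) = i"
    and w_alpha_last: "w_alpha n i j n = j"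
    and w_alpha_descending: "\<And>p. 1 \<le> p \<Longrightarrow> p < n - 2 \<Longrightarrow> w_alpha n i j (p + 1) < w_alpha n i j p"
proof -
  define xs where "xs = filter (\<lambda>v. v \<noteq> i \<and> v \<noteq> j) (rev [1..<n + 1])"
  define ys where "ys = xs @ [i, j]"
  have w: "w_alpha n i j = one_line ys" by (simp add: w_alpha_def ys_def xs_def)
  have set_xs: "set xs = {1..n} - {i, j}" by (auto simp: xs_def)
  have dxs: "distinct xs" by (simp add: xs_def)
  have "card ({1..n} - {i, j}) = n - 2" using assms by (subst card_Diff_subset) auto
  then have len_xs: "length xs = n - 2" using distinct_card[OF dxs] set_xs by simp
  have n: "n \<ge> 2" using assms by auto
  have len: "length ys = n" using len_xs n by (simp add: ys_def)
  have dys: "distinct ys" using dxs set_xs assms(3) by (auto simp: ys_def)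
  have "set ys = set xs \<union> {i, j}" by (simp add: ys_def insert_commute)
  also have "\<dots> = {1..n}" unfolding set_xs using assms(1,2) by blast
  finally have set_ys: "set ys = {1..n}" .
  have "bij_betw (one_line ys) {1..n} {1..n}"
  proof -
    \<comment> \<open>One-line notation counts positions from 1, lists count from 0.\<close>
    have "(\<lambda>k. k - 1) ` {1..n} \<subseteq> {..<n}" "Suc ` {..<n} \<subseteq> {1..n}" by auto
    then have "bij_betw (\<lambda>k. k - 1) {1..n} {..<n}"
      by (intro bij_betw_byWitness[where f' = Suc]) auto
    moreover have "bij_betw ((!) ys) {..<n} {1..n}"
      using dys len set_ys by (intro bij_betw_nth) simp_all
    ultimately have "bij_betw ((!) ys \<circ> (\<lambda>k. k - 1)) {1..n} {1..n}" by (rule bij_betw_trans)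
    moreover have "bij_betw ((!) ys \<circ> (\<lambda>k. k - 1)) {1..n} {1..n} \<longleftrightarrow> bij_betw (one_line ys) {1..n} {1..n}"
      using len by (intro bij_betw_cong) (simp add: one_line_def)
    ultimately show ?thesis by blast
  qed
  moreover have "one_line ys k = k" if "k \<notin> {1..n}" for k
    using that len by (auto simp: one_line_def)
  ultimately show "w_alpha n i j permutes {1..n}"
    unfolding w by (rule bij_imp_permutes)
  obtain m where m: "n = m + 2" using n le_Suc_ex by (metis add.commute)
  have "ys ! m = i" "ys ! Suc m = j" using len_xs by (simp_all add: ys_def nth_append m)
  then show "w_alpha n i j (n - 1) = i" "w_alpha n i j n = j"
    unfolding w one_line_def len by (simp_all add: m)
  have "sorted_wrt (>) xs"
    unfolding xs_def by (intro sorted_wrt_filter) (simp add: sorted_wrt_rev del: upt_Suc)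
  then have "xs ! p < xs ! (p - 1)" if "1 \<le> p" "p < n - 2" for p
    using that len_xs sorted_wrt_nth_less[of "(>)" xs "p - 1" p] by simp
  moreover have "w_alpha n i j (q + 1) = xs ! q" if "q < n - 2" for q
    using that len_xs unfolding w one_line_def len by (auto simp: ys_def nth_append)
  ultimately show "w_alpha n i j (p + 1) < w_alpha n i j p" if "1 \<le> p" "p < n - 2" for p
    using that by (metis le_add_diff_inverse2 less_imp_diff_less)
qed

text \<open>The last two entries determine the set of the other values, and a set has only one
  descending arrangement.\<close>

lemma eq_w_alphaI:
  assumes ij: "i \<in> {1..n}" "j \<in> {1..n}" "i \<noteq> j"
    and x: "x permutes {1..n}" "x (n - 1) = i" "x n = j"
    and desc: "\<And>p. 1 \<le> p \<Longrightarrow> p < n - 2 \<Longrightarrow> x (p + 1) < x p"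
  shows "x = w_alpha n i j"
proof -
  note w = w_alpha_props[OF ij]
  have n: "n \<ge> 2" using ij by auto
  have decomp: "{1..n} = insert n (insert (n - 1) {1..n - 2})" using n by auto
  have img: "y ` {1..n - 2} = {1..n} - {i, j}"
    if "y permutes {1..n}" "y (n - 1) = i" "y n = j" for y
  proof -
    have "{1..n - 2} = {1..n} - {n - 1, n}" using n by auto
    then have "y ` {1..n - 2} = y ` {1..n} - y ` {n - 1, n}"
      by (simp add: image_set_diff[OF permutes_inj[OF that(1)]])
    then show ?thesis using that permutes_image[OF that(1)] by simp
  qed
  \<comment> \<open>Negation in the integers makes the descending entries ascending.\<close>
  have "- int (x q) = - int (w_alpha n i j q)" if "q \<in> {1..n - 2}" for q
  proof (rule ascending_eqI[OF _ _ _ that])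
    have "x ` {1..n - 2} = w_alpha n i j ` {1..n - 2}" using img x w by simp
    then have "(\<lambda>v. - int v) ` x ` {1..n - 2} = (\<lambda>v. - int v) ` w_alpha n i j ` {1..n - 2}" by simp
    then show "(\<lambda>q. - int (x q)) ` {1..n - 2} = (\<lambda>q. - int (w_alpha n i j q)) ` {1..n - 2}"
      by (simp only: image_image)
  qed (use desc w(4) in auto)
  then have "x q = w_alpha n i j q" if "q \<in> {1..n}" for q
    using that x w(2,3) unfolding decomp by auto
  then show ?thesis
    using permutes_not_in[OF x(1)] permutes_not_in[OF w(1)] by (metis ext)
qed

text \<open>The value \<open>m + 1\<close> is one of the last two entries, so exchanging it with
  \<open>m\<close> disturbs no comparison among the first \<open>n - 2\<close> entries.\<close>

lemma simple_refl_comp_w_alpha: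
  assumes "i \<in> {1..n}" "j \<in> {1..n}" "i \<noteq> j" and m: "1 \<le> m" "m < n"
    and "m + 1 \<in> {i, j}" "m \<notin> {i, j}"
  shows "simple_refl m \<circ> w_alpha n i j = w_alpha n (simple_refl m i) (simple_refl m j)"
proof (rule eq_w_alphaI)
  note w = w_alpha_props[OF assms(1-3)]
  have s: "simple_refl m permutes {1..n}" using m by (rule simple_refl_permutes)
  show "simple_refl m i \<in> {1..n}" "simple_refl m j \<in> {1..n}"
    using permutes_in_image[OF s] assms by auto
  show "simple_refl m i \<noteq> simple_refl m j" using \<open>i \<noteq> j\<close> by (metis simple_refl_simple_refl)
  show "simple_refl m \<circ> w_alpha n i j permutes {1..n}" using w(1) s by (rule permutes_compose)
  show "(simple_refl m \<circ> w_alpha n i j) (n - 1) = simple_refl m i"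
    "(simple_refl m \<circ> w_alpha n i j) n = simple_refl m j" using w by simp_all
  fix p assume p: "1 \<le> p" "p < n - 2"
  have "w_alpha n i j q \<noteq> i \<and> w_alpha n i j q \<noteq> j" if "q < n - 1" for q
    using that w(2,3) permutes_inj[OF w(1)] by (metis injD less_irrefl diff_le_self order_less_le_trans)
  with p have "w_alpha n i j p \<noteq> m + 1" using assms(6) by fastforce
  then show "(simple_refl m \<circ> w_alpha n i j) (p + 1) < (simple_refl m \<circ> w_alpha n i j) p"
    using w(4)[OF p] by (auto simp: simple_refl_less_iff)
qed

text \<open>The value \<open>m\<close> stands among the first \<open>n - 2\<close> entries, hence to
  the left of \<open>m + 1\<close>; exchanging them creates an inversion.\<close>

lemma bruhat_step_w_alpha:
  assumes ij: "i \<in> {1..n}" "j \<in> {1..n}" "i \<noteq> j" and m: "1 \<le> m" "m < n"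
    and mi: "m + 1 \<in> {i, j}" "m \<notin> {i, j}"
  shows "bruhat_step (sym_group n) (simple_refls n)
    (w_alpha n i j) (w_alpha n (simple_refl m i) (simple_refl m j))"
proof -
  note w = w_alpha_props[OF ij]
  have n: "n \<ge> 2" using ij by auto
  obtain a where a: "a \<in> {1..n}" "w_alpha n i j a = m"
    using permutes_image[OF w(1)] m by (metis (no_types, lifting) atLeastAtMost_iff image_iff less_imp_le)
  have "a \<noteq> n - 1" "a \<noteq> n" using a w mi by auto
  moreover obtain b where "b \<in> {n - 1, n}" "w_alpha n i j b = m + 1" using w mi by auto
  ultimately have "bruhat_step (sym_group n) (simple_refls n)
      (w_alpha n i j) (simple_refl m \<circ> w_alpha n i j)"
    using a n by (intro bruhat_step_simple_refl_comp[of _ _ a b] w(1)) auto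
  then show ?thesis using simple_refl_comp_w_alpha[OF assms] by simp
qed

lemma bruhat_le_w_alpha_Suc:
  assumes "i \<in> {1..n}" "j \<in> {1..n}" "i \<noteq> j" "i < n" "j < n"
  shows "bruhat_le (sym_group n) (simple_refls n) (w_alpha n (i + 1) (j + 1)) (w_alpha n i j)"
proof -
  note step = bruhat_step_w_alpha[where n = n]
  show ?thesis
  proof (cases "j = i + 1")
    \<comment> \<open>Lowering \<open>j + 1\<close> to \<open>j\<close> first is possible because
      \<open>i + 1\<close> does not occupy the value \<open>j\<close>; this order also covers
      \<open>i = j + 1\<close>.\<close>
    case False
    then have "bruhat_step (sym_group n) (simple_refls n) (w_alpha n (i + 1) (j + 1)) (w_alpha n (i + 1) j)"
      "bruhat_step (sym_group n) (simple_refls n) (w_alpha n (i + 1) j) (w_alpha n i j)"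
      using step[of "i + 1" "j + 1" j] step[of "i + 1" j i] assms
      by (auto simp: simple_refl_def transpose_def)
    then show ?thesis unfolding bruhat_le_def by (meson converse_rtranclp_into_rtranclp r_into_rtranclp)
  next
    \<comment> \<open>Here \<open>i + 1\<close> occupies the value \<open>j\<close> and has to be
      lowered first.\<close>
    case True
    then have "bruhat_step (sym_group n) (simple_refls n) (w_alpha n (i + 1) (j + 1)) (w_alpha n i (j + 1))"
      "bruhat_step (sym_group n) (simple_refls n) (w_alpha n i (j + 1)) (w_alpha n i j)"
      using step[of "i + 1" "j + 1" i] step[of i "j + 1" j] assms
      by (auto simp: simple_refl_def transpose_def)
    then show ?thesis unfolding bruhat_le_def by (meson converse_rtranclp_into_rtranclp r_into_rtranclp)
  qed
qed

lemma bruhat_le_w_alpha_shift: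
  assumes "1 \<le> i" "1 \<le> j" "i \<noteq> j" "i + d \<le> n" "j + d \<le> n"
  shows "bruhat_le (sym_group n) (simple_refls n) (w_alpha n (i + d) (j + d)) (w_alpha n i j)"
  using assms
proof (induction d)
  case 0
  then show ?case by (simp add: bruhat_le_def)
next
  case (Suc d)
  then have "bruhat_le (sym_group n) (simple_refls n) (w_alpha n (i + d) (j + d)) (w_alpha n i j)"
    "bruhat_le (sym_group n) (simple_refls n) (w_alpha n (i + d + 1) (j + d + 1)) (w_alpha n (i + d) (j + d))"
    using bruhat_le_w_alpha_Suc[of "i + d" n "j + d"] by auto
  then show ?case unfolding bruhat_le_def by simp
qed


subsection \<open>Maximal coset representatives\<close>

lemma J_set_eq:
  assumes "n \<ge> 3"
  shows "J_set n = simple_refl ` {p. 1 \<le> p \<and> p < n - 2}"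
proof -
  \<comment> \<open>Injectivity turns the removal of two reflections into the removal of their
    indices.\<close>
  have "inj simple_refl"
  proof
    fix p q assume "simple_refl p = simple_refl q"
    then have "simple_refl p p = simple_refl q p" "simple_refl p q = simple_refl q q" by simp_all
    then show "p = q" by (auto simp: simple_refl_def transpose_def split: if_splits)
  qed
  then have "J_set n = simple_refl ` ({1..n - 1} - {n - 1, n - 2})"
    by (simp add: J_set_def simple_refls_def image_set_diff)
  also have "{1..n - 1} - {n - 1, n - 2} = {p. 1 \<le> p \<and> p < n - 2}" using assms by auto
  finally show ?thesis .
qed

lemma W_J_subgroup:
  assumes "n \<ge> 3"
  shows "subgroup (W_J n) (sym_group n)"
proof -
  interpret group "sym_group n" by (rule sym_group_is_group)
  have "J_set n \<subseteq> carrier (sym_group n)"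
    using simple_refl_permutes[of _ n] by (auto simp: J_set_eq[OF assms] sym_group_carrier)
  then show ?thesis unfolding W_J_def by (rule generate_is_subgroup)
qed

text \<open>The generators move only positions up to \<open>n - 2\<close>; hence all elements of a
  left coset share their last two entries.\<close>

lemma W_J_fixes:
  assumes "n \<ge> 3" "h \<in> W_J n"
  shows "h permutes {1..n} \<and> h (n - 1) = n - 1 \<and> h n = n"
proof -
  have refl: "s permutes {1..n} \<and> s (n - 1) = n - 1 \<and> s n = n" if "s \<in> J_set n" for s
    using that assms(1) by (auto simp: J_set_eq simple_refl_def intro!: permutes_swap_id)
  show ?thesis
    using assms(2) unfolding W_J_def
  proof (induction rule: generate.induct)
    case one
    then show ?case by (simp add: sym_group_one permutes_id[unfolded id_def] id_def)
  next
    case (incl h)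
    then show ?case by (rule refl)
  next
    case (inv h)
    then have h: "h permutes {1..n} \<and> h (n - 1) = n - 1 \<and> h n = n" by (rule refl)
    then have "inv\<^bsub>sym_group n\<^esub> h = inv_into UNIV h" by (simp add: inv_sym_group)
    then show ?case using h by (simp add: permutes_inv permutes_inv_eq[of h "{1..n}"])
  next
    case (eng h1 h2)
    then show ?case using permutes_compose[of h2 _ h1] by (simp add: sym_group_mult o_def)
  qed
qed

lemma bruhat_max_rep_w_alpha:
  assumes n: "n \<ge> 3" and ij: "i \<in> {1..n}" "j \<in> {1..n}" "i \<noteq> j"
  shows "bruhat_max_rep (sym_group n) (simple_refls n) (w_alpha n i j <#\<^bsub>sym_group n\<^esub> W_J n) = w_alpha n i j"
proof -
  interpret group "sym_group n" by (rule sym_group_is_group)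
  interpret H: subgroup "W_J n" "sym_group n" using n by (rule W_J_subgroup)
  note w = w_alpha_props[OF ij]
  let ?le = "bruhat_le (sym_group n) (simple_refls n)"
  let ?len = "cox_length (sym_group n) (simple_refls n)"
  define C where "C = w_alpha n i j <#\<^bsub>sym_group n\<^esub> W_J n"
  have C_eq: "C = (\<lambda>h. w_alpha n i j \<circ> h) ` W_J n"
    by (auto simp: C_def l_coset_def sym_group_def)
  have C: "x permutes {1..n} \<and> x (n - 1) = i \<and> x n = j" if x: "x \<in> C" for x
  proof -
    obtain h where "x = w_alpha n i j \<circ> h" "h \<in> W_J n" using x unfolding C_eq by blast
    then show ?thesis using W_J_fixes[OF n, of h] w(1-3) permutes_compose[of h _ "w_alpha n i j"] by simp
  qed
  \<comment> \<open>Ascents among the first \<open>n - 2\<close> positions can be reversed without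
    leaving the coset.\<close>
  have closed: "x \<circ> simple_refl p \<in> C" if x: "x \<in> C" and p: "1 \<le> p" "p < n - 2" for x p
  proof -
    have "simple_refl p \<in> J_set n" using p by (simp add: J_set_eq[OF n])
    then have "simple_refl p \<in> W_J n" unfolding W_J_def by (rule generate.incl)
    moreover obtain h where "x = w_alpha n i j \<circ> h" "h \<in> W_J n" using x unfolding C_eq by blast
    ultimately have "h \<circ> simple_refl p \<in> W_J n" "x \<circ> simple_refl p = w_alpha n i j \<circ> (h \<circ> simple_refl p)"
      using H.m_closed by (simp_all add: sym_group_mult comp_assoc)
    then show ?thesis unfolding C_eq by blast
  qed
  have unique: "x = w_alpha n i j" if x: "x \<in> C" and max: "\<forall>y\<in>C. ?le x y \<longrightarrow> y = x" for x
  proof (rule eq_w_alphaI[OF ij])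
    fix p assume p: "1 \<le> p" "p < n - 2"
    show "x (p + 1) < x p"
    proof (rule ccontr)
      assume "\<not> x (p + 1) < x p"
      moreover have "x p \<noteq> x (p + 1)"
        using inj_eq[OF permutes_inj] C[OF x] by (metis Suc_eq_plus1 n_not_Suc_n)
      ultimately have "bruhat_step (sym_group n) (simple_refls n) x (x \<circ> simple_refl p)"
        using C[OF x] p by (intro bruhat_step_comp_simple_refl) auto
      then have "?le x (x \<circ> simple_refl p)" "?len x < ?len (x \<circ> simple_refl p)"
        unfolding bruhat_le_def by (blast, simp add: bruhat_step_def)
      then show False using max closed[OF x p] by auto
    qed
  qed (use C[OF x] in auto)
  \<comment> \<open>The definite description also needs existence: an element of greatest length in
    the finite coset is maximal, and uniqueness identifies it with
    \<open>w_alpha n i j\<close>.\<close>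
  have "C \<subseteq> {x. x permutes {1..n}}" using C by blast
  then have "finite C" by (rule finite_subset) (simp add: finite_permutations)
  moreover have "C \<noteq> {}" using H.one_closed unfolding C_eq by blast
  ultimately have "Max (?len ` C) \<in> ?len ` C" "\<And>y. y \<in> C \<Longrightarrow> ?len y \<le> Max (?len ` C)" by auto
  then obtain z where z: "z \<in> C" "\<And>y. y \<in> C \<Longrightarrow> ?len y \<le> ?len z" by fastforce
  have zmax: "\<forall>y\<in>C. ?le z y \<longrightarrow> y = z"
    using z bruhat_le_imp_eq_or_length_less by (metis linorder_not_less)
  have "z = w_alpha n i j" using unique z zmax by blast
  then show ?thesis
    unfolding bruhat_max_rep_def C_def[symmetric] using z zmax unique by (intro the_equality) blast+
qed


subsection \<open>Heights\<close>

lemma height_root_vec: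
  assumes ij: "i \<in> {1..n}" "j \<in> {1..n}"
  shows "height n (root_vec i j) = real j - real i"
  unfolding height_def
proof (rule the_equality)
  \<comment> \<open>The functional weighting coordinate \<open>m\<close> by \<open>m\<close> takes
    the value -1 on every simple root, so it reads off minus the sum of the coefficients of any
    expansion.\<close>
  have sum_root: "(\<Sum>m=1..n. real m * root_vec a b m) = real a - real b"
    if "a \<in> {1..n}" "b \<in> {1..n}" for a b
  proof -
    have "(\<Sum>m=1..n. real m * eps a m) = real a" if "a \<in> {1..n}" for a
    proof -
      have "(\<Sum>m=1..n. real m * eps a m) = (\<Sum>m=1..n. if m = a then real m else 0)"
        by (intro sum.cong) (auto simp: eps_def)
      then show ?thesis using that by simp
    qed
    then show ?thesis using that by (simp add: root_vec_def right_diff_distrib sum_subtractf)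
  qed
  have h: "h = real j - real i"
    if v: "root_vec i j = (\<lambda>m. \<Sum>k = 1..n - 1. c k * simple_root k m)" and h: "h = (\<Sum>k = 1..n - 1. c k)"
    for c h
  proof -
    have "real i - real j = (\<Sum>m=1..n. real m * (\<Sum>k = 1..n - 1. c k * simple_root k m))"
      using sum_root[OF ij] unfolding v by simp
    also have "\<dots> = (\<Sum>k = 1..n - 1. c k * (\<Sum>m=1..n. real m * simple_root k m))"
      unfolding sum_distrib_left by (subst sum.swap) (simp add: mult_ac)
    also have "\<dots> = (\<Sum>k = 1..n - 1. - c k)"
      by (intro sum.cong refl) (subst simple_root_def, subst sum_root, auto)
    finally show ?thesis using h by (simp add: sum_negf)
  qed
  \<comment> \<open>The coefficients are 1 on \<open>i, ..., j - 1\<close> if \<open>i < j\<close>,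
    and -1 on \<open>j, ..., i - 1\<close> if \<open>j < i\<close>.\<close>
  define c :: "nat \<Rightarrow> real" where "c k = (if i \<le> k then 1 else 0) - (if j \<le> k then 1 else 0)" for k
  \<comment> \<open>At \<open>k = 0\<close> both indicators are 0, and from \<open>k = n\<close> on
    both are 1.\<close>
  have c_outside: "c k = 0" if "k \<notin> {1..n - 1}" for k
    using that ij by (auto simp: c_def)
  have v: "root_vec i j = (\<lambda>m. \<Sum>k = 1..n - 1. c k * simple_root k m)"
  proof
    fix m
    have "(\<Sum>k = 1..n - 1. c k * simple_root k m) =
        (\<Sum>k = 1..n - 1. if k = m then c k else 0) - (\<Sum>k = 1..n - 1. if k + 1 = m then c k else 0)"
      unfolding sum_subtractf[symmetric]
      by (intro sum.cong) (auto simp: simple_root_def root_vec_def eps_def)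
    \<comment> \<open>Truncation at \<open>m = 0\<close> is harmless, as the index 0 lies outside
      the range.\<close>
    also have "(\<Sum>k = 1..n - 1. if k + 1 = m then c k else 0) =
        (\<Sum>k = 1..n - 1. if k = m - 1 then c k else 0)"
      by (intro sum.cong) auto
    finally have "(\<Sum>k = 1..n - 1. c k * simple_root k m) = c m - c (m - 1)"
      by (simp add: c_outside)
    moreover have "(if a \<le> m then 1 else 0) - (if a \<le> m - 1 then 1 else 0) = eps a m" if "1 \<le> a" for a
      using that by (auto simp: eps_def)
    ultimately show "root_vec i j m = (\<Sum>k = 1..n - 1. c k * simple_root k m)"
      using ij unfolding root_vec_def c_def by (smt (verit) atLeastAtMost_iff)
  qed
  then show "\<exists>c. root_vec i j = (\<lambda>m. \<Sum>k = 1..n - 1. c k * simple_root k m) \<and>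
      real j - real i = (\<Sum>k = 1..n - 1. c k)"
    using h[OF v refl] by (intro exI[of _ c] conjI) simp_all
  show "h = real j - real i"
    if "\<exists>c. root_vec i j = (\<lambda>m. \<Sum>k = 1..n - 1. c k * simple_root k m) \<and> h = (\<Sum>k = 1..n - 1. c k)"
    for h using that by (elim exE conjE) (rule h)
qed

theorem mainTheorem1:
  fixes n i j k l :: nat
  assumes "n \<ge> 3"
    and "i \<in> {1..n}" and "j \<in> {1..n}" and "i \<noteq> j"
    and "k \<in> {1..n}" and "l \<in> {1..n}" and "k \<noteq> l"
    and "height n (root_vec i j) = height n (root_vec k l)"
  shows "(coset_bruhat_le (sym_group n) (simple_refls n)
            (w_alpha n i j <#\<^bsub>sym_group n\<^esub> W_J n) (w_alpha n k l <#\<^bsub>sym_group n\<^esub> W_J n) \<or>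
          coset_bruhat_le (sym_group n) (simple_refls n)
            (w_alpha n k l <#\<^bsub>sym_group n\<^esub> W_J n) (w_alpha n i j <#\<^bsub>sym_group n\<^esub> W_J n)) \<and>
         (bruhat_le (sym_group n) (simple_refls n) (w_alpha n i j) (w_alpha n k l) \<or>
          bruhat_le (sym_group n) (simple_refls n) (w_alpha n k l) (w_alpha n i j))"
proof -
  have "real j - real i = real l - real k"
    using assms by (simp add: height_root_vec)
  \<comment> \<open>Sums avoid truncated subtraction, since heights may be negative.\<close>
  then have eq: "j + k = l + i" by linarith
  have "bruhat_le (sym_group n) (simple_refls n) (w_alpha n i j) (w_alpha n k l) \<or>
      bruhat_le (sym_group n) (simple_refls n) (w_alpha n k l) (w_alpha n i j)"
  \<comment> \<open>The pair with the larger indices is a shift of the other and gives the smaller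
    permutation.\<close>
  proof (cases "i \<le> k")
    case True
    then obtain d where "k = i + d" "l = j + d" using eq le_Suc_ex by fastforce
    then show ?thesis using bruhat_le_w_alpha_shift[of i j d n] assms by auto
  next
    case False
    then obtain d where "i = k + d" "j = l + d" using eq le_Suc_ex[of k i] by fastforce
    then show ?thesis using bruhat_le_w_alpha_shift[of k l d n] assms by auto
  qed
  then show ?thesis
    using assms by (simp add: coset_bruhat_le_def bruhat_max_rep_w_alpha)
qed

end
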